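(* (Sample size two.) Fix $d\ge2$, a $d\times d$ stochastic matrix $P$, $\bm x$ in the simplex and $t\ge0$. As $\theta\to0$, for $a\in[d]$, \[ p(2\bm e_a;t,\bm x)=x_a^2(1-\theta t)e^{-t}+\theta te^{-t}x_a\sum_{j\in[d]}x_jP_{ja}+\big(\bm xe^{t\gamma}\big)_a(1-e^{-t})+\theta\Big\{\big(\bm xe^{t\gamma}\big)_a(P_{aa}-1)-\tfrac12\big(\bm xe^{t\gamma}(P-I)\big)_a\Big\}\big(1-(1+t)e^{-t}\big)+o(\theta), \] and for $a\ne b$, \[ p(\bm e_a+\bm e_b;t,\bm x)=2x_ax_b(1-\theta t)e^{-t}+\theta te^{-t}\sum_{j\in[d]}\big(x_ax_jP_{jb}+x_bx_jP_{ja}\big)+\theta\Big\{\big(\bm xe^{t\gamma}\big)_aP_{ab}+\big(\bm xe^{t\gamma}\big)_bP_{ba}\Big\}\big(1-(1+t)e^{-t}\big)+o(\theta). \]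
   Context: Wright–Fisher diffusion: $\theta>0$, $P$ a $d\times d$ stochastic matrix, $\gamma=\frac{\theta}{2}(P-I)$; $\{\bm X(t)\}_{t\ge0}$ is the diffusion on the simplex with generator $\mathcal L=\frac12\sum_{i,j=1}^d x_i(\delta_{ij}-x_j)\frac{\partial^2}{\partial x_i\partial x_j}+\sum_{i,j=1}^d\gamma_{ji}x_j\frac{\partial}{\partial x_i}$. For $\bm n\in\mathbb Z^d_{\ge0}$ with $|\bm n|=n$, $m(\bm n;n,\bm p)=\binom{n}{\bm n}\prod_j p_j^{n_j}$ and $p(\bm n;t,\bm x)=\mathbb E[m(\bm n;n,\bm X(t))\mid\bm X(0)=\bm x]$; $\bm e_a$ is the $a$-th unit vector and $\bm xe^{t\gamma}$ is a row vector times a matrix exponential. *)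

theory Defs
  imports "HOL-Analysis.Analysis" "HOL-Probability.Probability" "HOL-Library.Landau_Symbols"
begin

definition mpow :: "real^'d^'d \<Rightarrow> nat \<Rightarrow> real^'d^'d" where
  "mpow A k = ((\<lambda>B. A ** B) ^^ k) (mat 1)"

definition mexp :: "real^'d^'d \<Rightarrow> real^'d^'d" where
  "mexp A = (\<Sum>k. (1 / fact k) *\<^sub>R mpow A k)"

definition stochastic :: "real^'d^'d \<Rightarrow> bool" where
  "stochastic P \<longleftrightarrow> (\<forall>i j. 0 \<le> P$i$j) \<and> (\<forall>i. (\<Sum>j\<in>UNIV. P$i$j) = 1)"

definition prob_simplex :: "(real^'d) set" where
  "prob_simplex = {x. (\<forall>i. 0 \<le> x$i) \<and> (\<Sum>i\<in>UNIV. x$i) = 1}"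

definition gammaM :: "real \<Rightarrow> real^'d^'d \<Rightarrow> real^'d^'d" where
  "gammaM \<theta> P = (\<theta> / 2) *\<^sub>R (P - mat 1)"

definition pd :: "'d::finite \<Rightarrow> (real^'d \<Rightarrow> real) \<Rightarrow> real^'d \<Rightarrow> real" where
  "pd i f x = deriv (\<lambda>s. f (x + s *\<^sub>R axis i 1)) 0"

definition WFgen :: "real \<Rightarrow> real^'d^'d \<Rightarrow> (real^'d \<Rightarrow> real) \<Rightarrow> real^'d \<Rightarrow> real" where
  "WFgen \<theta> P f x =
     (1/2) * (\<Sum>i\<in>UNIV. \<Sum>j\<in>UNIV. x$i * ((if i = j then 1 else 0) - x$j) * pd i (pd j f) x)
     + (\<Sum>i\<in>UNIV. \<Sum>j\<in>UNIV. (gammaM \<theta> P)$j$i * x$j * pd i f x)"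

definition polyfun :: "(real^'d \<Rightarrow> real) \<Rightarrow> bool" where
  "polyfun f \<longleftrightarrow> (\<exists>S c. finite S \<and>
      f = (\<lambda>x. \<Sum>k\<in>S. c k * (\<Prod>j\<in>UNIV. x$j ^ k j)))"

text \<open>A Wright--Fisher diffusion started at x, given through the martingale problem
  in expectation form (Dynkin's formula) for all polynomial test functions.\<close>
definition WF_process :: "real \<Rightarrow> real^'d^'d \<Rightarrow> real^'d \<Rightarrow> 'w measure
      \<Rightarrow> (real \<Rightarrow> 'w \<Rightarrow> real^'d) \<Rightarrow> bool" where
  "WF_process \<theta> P x M X \<longleftrightarrow>
     prob_space M \<and>
     (\<forall>t\<ge>0. X t \<in> borel_measurable M) \<and>
     (\<forall>t\<ge>0. AE \<omega> in M. X t \<omega> \<in> prob_simplex) \<and>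
     (AE \<omega> in M. X 0 \<omega> = x) \<and>
     (\<forall>f. polyfun f \<longrightarrow> (\<forall>t\<ge>0.
        ((\<lambda>s. \<integral>\<omega>. WFgen \<theta> P f (X s \<omega>) \<partial>M) has_integral
           ((\<integral>\<omega>. f (X t \<omega>) \<partial>M) - f x)) {0..t}))"

definition mult :: "('d::finite \<Rightarrow> nat) \<Rightarrow> real^'d \<Rightarrow> real" where
  "mult n p = fact (\<Sum>j\<in>UNIV. n j) / (\<Prod>j\<in>UNIV. fact (n j)) * (\<Prod>j\<in>UNIV. p$j ^ n j)"

definition unitv :: "'d \<Rightarrow> 'd \<Rightarrow> nat" where
  "unitv a = (\<lambda>j. if j = a then 1 else 0)"

end

theory Submission
  imports Defs
begin

text \<open>Dynkin's formula for the coordinate functions and their pairwise products turns the first and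
  second moments of \<open>X(t)\<close> into a closed linear system of ODEs in which every mutation term carries
  a factor \<open>\<theta>\<close>. Comparing with the neutral solution (\<open>\<theta> = 0\<close>) and its first variation by a
  variation-of-constants estimate on \<open>[0, t]\<close> gives \<open>E[X\<^sub>a X\<^sub>b](t)\<close> up to \<open>O(\<theta>\<^sup>2)\<close>.
  The exponential series gives \<open>x e\<^sup>t\<^sup>\<gamma> = x + (\<theta>t/2) x (P - I) + O(\<theta>\<^sup>2)\<close>, and with it the
  stated closed forms agree with the same expansion up to \<open>O(\<theta>\<^sup>2)\<close>.\<close>

lemma continuous_on_of_has_integral_indefinite:
  fixes m g :: "real \<Rightarrow> real"
  assumes "T \<ge> 0" and m: "\<And>s. 0 \<le> s \<Longrightarrow> (g has_integral (m s - m0)) {0..s}"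
  shows "continuous_on {0..T} m"
proof -
  have "continuous_on {0..T} (\<lambda>s. m0 + integral {0..s} g)"
    using m[of T] \<open>T \<ge> 0\<close> by (intro continuous_intros indefinite_integral_continuous_1) auto
  moreover have "m0 + integral {0..s} g = m s" if "s \<in> {0..T}" for s
    using integral_unique[OF m] that by auto
  ultimately show ?thesis by (rule continuous_on_eq) auto
qed

lemma has_real_derivative_of_has_integral_indefinite:
  fixes m g :: "real \<Rightarrow> real"
  assumes m: "\<And>s. 0 \<le> s \<Longrightarrow> (g has_integral (m s - m0)) {0..s}"
    and "continuous_on {0..T} g" and s: "s \<in> {0..T}"
  shows "(m has_real_derivative g s) (at s within {0..T})"
proof -
  have "((\<lambda>u. integral {0..u} g) has_real_derivative g s) (at s within {0..T})"
    using integral_has_vector_derivative[OF assms(2) s]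
    by (simp add: has_real_derivative_iff_has_vector_derivative)
  then have d: "((\<lambda>u. m0 + integral {0..u} g) has_real_derivative g s) (at s within {0..T})"
    using DERIV_add[OF DERIV_const] by fastforce
  have "m0 + integral {0..u} g = m u" if "u \<in> {0..T}" for u
    using integral_unique[OF m] that by auto
  then show ?thesis
    by (intro has_field_derivative_transform_within[OF d, where d = 1]) (use s in auto)
qed

lemma increment_le_of_derivative_bound:
  fixes f f' :: "real \<Rightarrow> real"
  assumes "\<And>z. z \<in> {0..T} \<Longrightarrow> (f has_real_derivative f' z) (at z within {0..T})"
    and "\<And>z. z \<in> {0..T} \<Longrightarrow> \<bar>f' z\<bar> \<le> B" and s: "s \<in> {0..T}"
  shows "\<bar>f s - f 0\<bar> \<le> B * s"
  using field_differentiable_bound[of "{0..T}" f f' B s 0] assms by auto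

text \<open>Variation of constants: \<open>(e\<^sup>z e z)' = e\<^sup>z r z\<close>, so the relaxation term \<open>-e\<close> costs nothing.\<close>
lemma relaxation_bound:
  fixes e r :: "real \<Rightarrow> real"
  assumes e: "\<And>z. z \<in> {0..T} \<Longrightarrow> (e has_real_derivative (r z - e z)) (at z within {0..T})"
    and r: "\<And>z. z \<in> {0..T} \<Longrightarrow> \<bar>r z\<bar> \<le> B" and "e 0 = 0" and s: "s \<in> {0..T}"
  shows "\<bar>e s\<bar> \<le> B * s"
proof -
  have sub: "{0..s} \<subseteq> {0..T}" using s by auto
  have "((\<lambda>z. exp z * e z) has_real_derivative exp z * r z) (at z within {0..s})"
    if "z \<in> {0..s}" for z
  proof -
    have "(e has_real_derivative (r z - e z)) (at z within {0..s})"
      using DERIV_subset[OF e sub] that sub by blast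
    then show ?thesis by (auto intro!: derivative_eq_intros simp: algebra_simps)
  qed
  moreover have "\<bar>exp z * r z\<bar> \<le> exp s * B" if "z \<in> {0..s}" for z
    using r[of z] that sub by (auto simp: abs_mult intro!: mult_mono)
  ultimately have "\<bar>exp s * e s - exp 0 * e 0\<bar> \<le> exp s * B * s"
    using s by (intro increment_le_of_derivative_bound[of s]) auto
  then show ?thesis using \<open>e 0 = 0\<close> by (simp add: abs_mult)
qed

lemma smallo_at_right_0_of_quadratic_bound:
  fixes f :: "real \<Rightarrow> real"
  assumes bound: "\<And>\<theta>. 0 < \<theta> \<Longrightarrow> \<theta> \<le> 1 \<Longrightarrow> \<bar>f \<theta>\<bar> \<le> C * \<theta>^2"
  shows "f \<in> o[at_right 0](\<lambda>\<theta>. \<theta>)"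
proof (rule landau_o.smallI)
  fix c :: real assume c: "c > 0"
  define \<delta> where "\<delta> = min 1 (c / (\<bar>C\<bar> + 1))"
  have "\<bar>f \<theta>\<bar> \<le> c * \<theta>" if \<theta>: "0 < \<theta>" "\<theta> < \<delta>" for \<theta>
  proof -
    have "\<bar>f \<theta>\<bar> \<le> (\<bar>C\<bar> + 1) * \<theta> * \<theta>"
      using bound[of \<theta>] \<theta> by (auto simp: \<delta>_def power2_eq_square intro: order_trans mult_right_mono)
    also have "\<dots> \<le> c * \<theta>"
      using \<theta> c by (intro mult_right_mono) (auto simp: \<delta>_def field_simps)
    finally show ?thesis .
  qed
  moreover have "0 < \<delta>" using c by (simp add: \<delta>_def)
  ultimately show "eventually (\<lambda>\<theta>. norm (f \<theta>) \<le> c * norm \<theta>) (at_right 0)"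
    unfolding eventually_at_right_field by (intro exI[of _ \<delta>]) auto
qed

lemma prob_simplex_nth_bounds: "y \<in> prob_simplex \<Longrightarrow> 0 \<le> y$j \<and> y$j \<le> 1"
  unfolding prob_simplex_def using member_le_sum[of j UNIV "\<lambda>i. y$i"] by auto

lemma stochastic_minus_id_bound: "stochastic P \<Longrightarrow> \<bar>(P - mat 1)$i$j\<bar> \<le> 1"
  unfolding stochastic_def using member_le_sum[of j UNIV "\<lambda>k. P$i$k"] by (auto simp: mat_def)

lemma abs_sum_le_card_mult:
  assumes "\<And>j. \<bar>f j\<bar> \<le> c"
  shows "\<bar>\<Sum>j\<in>(UNIV::'d::finite set). f j\<bar> \<le> real CARD('d) * (c::real)"
  by (rule order_trans[OF sum_abs]) (use sum_bounded_above[of UNIV "\<lambda>j. \<bar>f j\<bar>" c] assms in auto)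

lemma abs_mult_le: "\<bar>u\<bar> \<le> U \<Longrightarrow> \<bar>v\<bar> \<le> V \<Longrightarrow> \<bar>u * v\<bar> \<le> U * (V::real)"
  by (simp add: abs_mult mult_mono')

lemma vector_matrix_mult_nth: "(x v* Q) $ a = (\<Sum>j\<in>UNIV. x$j * Q$j$a)"
  by (simp add: vector_matrix_mult_def mult.commute)

lemma gammaM_nth: "gammaM \<theta> P $ j $ i = \<theta> / 2 * (P - mat 1) $ j $ i"
  by (simp add: gammaM_def)

lemma mat_1_nth: "mat 1 $ i $ j = (if i = j then 1 else 0)"
  by (simp add: mat_def)

lemma abs_vector_matrix_mult_nth_le:
  fixes x :: "real^'d::finite"
  assumes x: "x \<in> prob_simplex" and A: "\<And>i j. \<bar>A$i$j\<bar> \<le> 1"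
  shows "\<bar>(x v* A)$a\<bar> \<le> real CARD('d)"
proof -
  have "\<bar>x$j * A$j$a\<bar> \<le> 1" for j
    using abs_mult_le[of "x$j" 1 "A$j$a" 1] A prob_simplex_nth_bounds[OF x, of j] by simp
  from abs_sum_le_card_mult[of "\<lambda>j. x$j * A$j$a" 1, OF this] show ?thesis by (simp add: vector_matrix_mult_nth)
qed

lemma abs_one_minus_one_plus_exp_le: "0 \<le> t \<Longrightarrow> \<bar>1 - (1 + t) * exp (-t)\<bar> \<le> (1::real)"
proof -
  assume t: "0 \<le> t"
  have "(1 + t) * exp (-t) \<le> exp t * exp (-t)"
    using exp_ge_add_one_self[of t] by (intro mult_right_mono) auto
  then show ?thesis using t by (simp add: exp_minus)
qed

section \<open>The generator on linear and quadratic monomials\<close>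

lemma pd_affine:
  "pd i (\<lambda>x. u * x$a + v * x$b + w) y = u * (if i = a then 1 else 0) + v * (if i = b then 1 else 0)"
  unfolding pd_def by (rule DERIV_imp_deriv) (auto simp: axis_def intro!: derivative_eq_intros)

lemma pd_nth: "pd i (\<lambda>x. x$a) y = (if i = a then 1 else 0)"
  using pd_affine[of i 1 a 0 a 0 y] by simp

lemma pd_const: "pd i (\<lambda>x. w) y = 0"
  using pd_affine[of i 0 a 0 a w y] by simp

lemma pd_nth_mult_nth:
  "pd i (\<lambda>x. x$a * x$b) y = (if i = a then 1 else 0) * y$b + (if i = b then 1 else 0) * y$a"
  unfolding pd_def by (rule DERIV_imp_deriv) (auto simp: axis_def intro!: derivative_eq_intros)

lemma pd_pd_nth_mult_nth:
  "pd j (pd i (\<lambda>x. x$a * x$b)) y =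
    (if i = a then 1 else 0) * (if j = b then 1 else 0) + (if i = b then 1 else 0) * (if j = a then 1 else 0)"
proof -
  have "pd i (\<lambda>x. x$a * x$b) = (\<lambda>x. (if i = a then 1 else 0) * x$b + (if i = b then 1 else 0) * x$a + 0)"
    by (rule ext) (simp add: pd_nth_mult_nth)
  then show ?thesis by (simp only: pd_affine)
qed

lemma sum_mult_delta: "(\<Sum>j\<in>(UNIV::'d::finite set). g j * (if j = b then 1 else 0)) = (g b :: real)"
  by (simp add: if_distrib[of "(*) _"] cong: if_cong)

lemma WFgen_nth: "WFgen \<theta> P (\<lambda>x. x$a) y = (\<Sum>j\<in>UNIV. gammaM \<theta> P $ j $ a * y$j)"
proof -
  have "pd i (\<lambda>x. x$a) = (\<lambda>x. if i = a then 1 else 0)" for i by (rule ext) (simp add: pd_nth)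
  then show ?thesis unfolding WFgen_def
    by (simp add: pd_const if_distrib cong: if_cong) (subst sum.swap, simp)
qed

lemma WFgen_nth_mult_nth:
  "WFgen \<theta> P (\<lambda>x. x$a * x$b) y =
     (if a = b then y$a else 0) - y$a * y$b + (\<Sum>j\<in>UNIV. gammaM \<theta> P $ j $ a * y$j) * y$b
       + (\<Sum>j\<in>UNIV. gammaM \<theta> P $ j $ b * y$j) * y$a"
proof -
  define A where "A i j = y$i * ((if i = j then 1 else 0) - y$j)" for i j
  have diffusion: "(\<Sum>i\<in>UNIV. \<Sum>j\<in>UNIV. A i j * pd i (pd j (\<lambda>x. x$a * x$b)) y) = A b a + A a b"
  proof -
    have "(\<Sum>j\<in>UNIV. A i j * pd i (pd j (\<lambda>x. x$a * x$b)) y)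
        = (\<Sum>j\<in>UNIV. (A i j * (if i = b then 1 else 0)) * (if j = a then 1 else 0)
                 + (A i j * (if i = a then 1 else 0)) * (if j = b then 1 else 0))" for i
      unfolding pd_pd_nth_mult_nth by (rule sum.cong) (auto simp: algebra_simps)
    then show ?thesis by (simp only: sum.distrib sum_mult_delta)
  qed
  have drift: "(\<Sum>i\<in>UNIV. \<Sum>j\<in>UNIV. gammaM \<theta> P $ j $ i * y $ j * pd i (\<lambda>x. x $ a * x $ b) y)
     = (\<Sum>j\<in>UNIV. gammaM \<theta> P $ j $ a * y$j) * y$b + (\<Sum>j\<in>UNIV. gammaM \<theta> P $ j $ b * y$j) * y$a"
  proof -
    have "(\<Sum>i\<in>UNIV. \<Sum>j\<in>UNIV. gammaM \<theta> P $ j $ i * y $ j * pd i (\<lambda>x. x $ a * x $ b) y)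
      = (\<Sum>i\<in>UNIV. (\<Sum>j\<in>UNIV. gammaM \<theta> P $ j $ i * y $ j * y$b) * (if i = a then 1 else 0)
          + (\<Sum>j\<in>UNIV. gammaM \<theta> P $ j $ i * y $ j * y$a) * (if i = b then 1 else 0))"
      unfolding pd_nth_mult_nth
      by (rule sum.cong) (auto simp: algebra_simps sum_distrib_right sum.distrib)
    also have "\<dots> = (\<Sum>j\<in>UNIV. gammaM \<theta> P $ j $ a * y $ j * y$b) + (\<Sum>j\<in>UNIV. gammaM \<theta> P $ j $ b * y $ j * y$a)"
      by (simp only: sum.distrib sum_mult_delta)
    finally show ?thesis by (simp add: sum_distrib_right)
  qed
  show ?thesis
    unfolding WFgen_def drift diffusion[unfolded A_def] by (simp add: A_def algebra_simps)
qed

lemma prod_power_delta: "(\<Prod>j\<in>(UNIV::'d::finite set). (y::real^'d)$j ^ (if j = a then 1 else 0)) = y$a"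
  by (simp add: if_distrib[of "power _"] cong: if_cong)

lemma polyfun_nth: "polyfun (\<lambda>x::real^'d::finite. x$a)"
  unfolding polyfun_def
  by (rule exI[of _ "{\<lambda>j. if j = a then 1 else 0}"], rule exI[of _ "\<lambda>_. 1"]) (simp add: prod_power_delta)

lemma polyfun_nth_mult_nth: "polyfun (\<lambda>x::real^'d::finite. x$a * x$b)"
  unfolding polyfun_def
  by (rule exI[of _ "{\<lambda>j. (if j = a then 1 else 0) + (if j = b then 1 else 0)}"], rule exI[of _ "\<lambda>_. 1"])
     (simp add: power_add prod.distrib prod_power_delta)

section \<open>Moment equations\<close>

locale wright_fisher =
  fixes \<theta> :: real and P :: "real^'d::finite^'d" and x :: "real^'d"
    and M :: "'w measure" and X :: "real \<Rightarrow> 'w \<Rightarrow> real^'d"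
  assumes process: "WF_process \<theta> P x M X"
    and stochastic: "stochastic P" and nonneg: "0 \<le> \<theta>"
begin

abbreviation Q :: "real^'d^'d" where "Q \<equiv> P - mat 1"

definition mean :: "'d \<Rightarrow> real \<Rightarrow> real" where
  "mean a s = (\<integral>\<omega>. X s \<omega> $ a \<partial>M)"

definition moment2 :: "'d \<Rightarrow> 'd \<Rightarrow> real \<Rightarrow> real" where
  "moment2 a b s = (\<integral>\<omega>. X s \<omega> $ a * X s \<omega> $ b \<partial>M)"

lemma Q_bound: "\<bar>Q$i$j\<bar> \<le> 1"
  by (rule stochastic_minus_id_bound[OF stochastic])

lemma prob_space: "prob_space M"
  using process by (simp add: WF_process_def)

lemma
  assumes s: "s \<ge> 0"
  shows integrable_nth: "integrable M (\<lambda>\<omega>. X s \<omega> $ a)"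
    and integrable_nth_mult_nth: "integrable M (\<lambda>\<omega>. X s \<omega> $ a * X s \<omega> $ b)"
    and abs_mean_le_1: "\<bar>mean a s\<bar> \<le> 1"
    and abs_moment2_le_1: "\<bar>moment2 a b s\<bar> \<le> 1"
proof -
  interpret prob_space M by (rule prob_space)
  have meas: "X s \<in> borel_measurable M" and ae: "AE \<omega> in M. X s \<omega> \<in> prob_simplex"
    using process s unfolding WF_process_def by auto
  have nth_meas: "(\<lambda>\<omega>. X s \<omega> $ i) \<in> borel_measurable M" for i
    by (rule measurable_compose[OF meas borel_measurable_nth])
  have unit: "AE \<omega> in M. \<forall>i. 0 \<le> X s \<omega> $ i \<and> X s \<omega> $ i \<le> 1"
    using ae by eventually_elim (use prob_simplex_nth_bounds in blast)
  then have prod_unit: "AE \<omega> in M. \<bar>X s \<omega> $ a * X s \<omega> $ b\<bar> \<le> 1"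
    by eventually_elim (auto simp: abs_mult intro: mult_le_one)
  show i1: "integrable M (\<lambda>\<omega>. X s \<omega> $ a)"
    by (rule integrable_const_bound[where B = 1]) (use unit nth_meas in \<open>auto elim!: AE_mp\<close>)
  show i2: "integrable M (\<lambda>\<omega>. X s \<omega> $ a * X s \<omega> $ b)"
    by (rule integrable_const_bound[where B = 1]) (use prod_unit nth_meas in auto)
  have "0 \<le> mean a s" "mean a s \<le> 1"
    unfolding mean_def using unit by (auto intro!: integral_ge_const integral_le_const i1 elim!: AE_mp)
  then show "\<bar>mean a s\<bar> \<le> 1" by auto
  have "-1 \<le> moment2 a b s" "moment2 a b s \<le> 1"
    unfolding moment2_def using prod_unit
    by (auto intro!: integral_ge_const integral_le_const i2 elim!: AE_mp)
  then show "\<bar>moment2 a b s\<bar> \<le> 1" by auto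
qed

lemma dynkin:
  assumes "polyfun f" and "s \<ge> 0"
  shows "((\<lambda>r. \<integral>\<omega>. WFgen \<theta> P f (X r \<omega>) \<partial>M) has_integral ((\<integral>\<omega>. f (X s \<omega>) \<partial>M) - f x)) {0..s}"
  using process assms unfolding WF_process_def by blast

lemma mean_has_integral:
  assumes s: "s \<ge> 0"
  shows "((\<lambda>r. \<theta> / 2 * (\<Sum>j\<in>UNIV. Q$j$a * mean j r)) has_integral (mean a s - x$a)) {0..s}"
proof -
  have generator: "(\<integral>\<omega>. WFgen \<theta> P (\<lambda>y. y$a) (X r \<omega>) \<partial>M) = \<theta> / 2 * (\<Sum>j\<in>UNIV. Q$j$a * mean j r)"
    if "r \<in> {0..s}" for r
    using that unfolding WFgen_nth gammaM_nth mean_def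
    by (simp add: integrable_nth integral_sum sum_distrib_left mult.assoc)
  have "((\<lambda>r. \<integral>\<omega>. WFgen \<theta> P (\<lambda>y. y$a) (X r \<omega>) \<partial>M) has_integral (mean a s - x$a)) {0..s}"
    using dynkin[OF polyfun_nth s] by (simp add: mean_def)
  then show ?thesis by (rule has_integral_eq[rotated]) (use generator in auto)
qed

lemma moment2_has_integral:
  assumes s: "s \<ge> 0"
  shows "((\<lambda>r. (if a = b then mean a r else 0) - moment2 a b r
             + \<theta> / 2 * (\<Sum>j\<in>UNIV. Q$j$a * moment2 j b r) + \<theta> / 2 * (\<Sum>j\<in>UNIV. Q$j$b * moment2 j a r))
           has_integral (moment2 a b s - x$a * x$b)) {0..s}"
proof -
  have generator: "(\<integral>\<omega>. WFgen \<theta> P (\<lambda>y. y$a * y$b) (X r \<omega>) \<partial>M)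
      = (if a = b then mean a r else 0) - moment2 a b r
          + \<theta> / 2 * (\<Sum>j\<in>UNIV. Q$j$a * moment2 j b r) + \<theta> / 2 * (\<Sum>j\<in>UNIV. Q$j$b * moment2 j a r)"
    if "r \<in> {0..s}" for r
  proof -
    have r: "r \<ge> 0" using that by auto
    have "WFgen \<theta> P (\<lambda>y. y$a * y$b) (X r \<omega>) =
       (if a = b then X r \<omega> $ a else 0) - X r \<omega> $ a * X r \<omega> $ b
        + (\<Sum>j\<in>UNIV. gammaM \<theta> P $ j $ a * (X r \<omega> $ j * X r \<omega> $ b))
        + (\<Sum>j\<in>UNIV. gammaM \<theta> P $ j $ b * (X r \<omega> $ j * X r \<omega> $ a))" for \<omega>
      unfolding WFgen_nth_mult_nth by (simp add: sum_distrib_left sum_distrib_right mult_ac)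
    then show ?thesis
      unfolding mean_def moment2_def
      by (simp add: integrable_nth[OF r] integrable_nth_mult_nth[OF r] integral_sum gammaM_nth
          sum_distrib_left mult.assoc cong: if_cong)
  qed
  have "((\<lambda>r. \<integral>\<omega>. WFgen \<theta> P (\<lambda>y. y$a * y$b) (X r \<omega>) \<partial>M) has_integral (moment2 a b s - x$a * x$b)) {0..s}"
    using dynkin[OF polyfun_nth_mult_nth s] by (simp add: moment2_def)
  then show ?thesis by (rule has_integral_eq[rotated]) (use generator in auto)
qed

end

section \<open>The neutral second moment and its first-order correction\<close>

definition neutral_moment2 :: "real^'d \<Rightarrow> 'd \<Rightarrow> 'd \<Rightarrow> real \<Rightarrow> real" where
  "neutral_moment2 x a b s = exp (-s) * x$a * x$b + (if a = b then (1 - exp (-s)) * x$a else 0)"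

definition moment2_correction :: "real^'d^'d \<Rightarrow> real^'d \<Rightarrow> 'd \<Rightarrow> 'd \<Rightarrow> real \<Rightarrow> real" where
  "moment2_correction Q x a b s =
     (if a = b then (s - 1 + exp (-s)) * (x v* Q)$a / 2 else 0)
     + s * exp (-s) / 2 * ((x v* Q)$a * x$b + x$a * (x v* Q)$b)
     + (1 - (1 + s) * exp (-s)) / 2 * (Q$b$a * x$b + x$a * Q$a$b)"

lemma neutral_moment2_0: "neutral_moment2 x a b 0 = x$a * x$b"
  by (simp add: neutral_moment2_def)

lemma moment2_correction_0: "moment2_correction Q x a b 0 = 0"
  by (simp add: moment2_correction_def)

lemma neutral_moment2_has_derivative:
  "((\<lambda>s. neutral_moment2 x a b s) has_real_derivative
     ((if a = b then x$a else 0) - neutral_moment2 x a b s)) (at s within A)"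
  unfolding neutral_moment2_def
  by (cases "a = b") (auto intro!: derivative_eq_intros simp: algebra_simps)

lemma sum_mult_neutral_moment2:
  "(\<Sum>j\<in>UNIV. Q$j$a * neutral_moment2 x j b s)
     = exp (-s) * (x v* Q)$a * x$b + (1 - exp (-s)) * Q$b$a * x$b"
proof -
  have "(\<Sum>j\<in>UNIV. Q$j$a * neutral_moment2 x j b s)
      = (\<Sum>j\<in>UNIV. exp (-s) * x$b * (x$j * Q$j$a))
        + (\<Sum>j\<in>UNIV. if j = b then Q$j$a * ((1 - exp (-s)) * x$j) else 0)"
    unfolding neutral_moment2_def sum.distrib[symmetric] by (rule sum.cong) (auto simp: algebra_simps)
  also have "\<dots> = exp (-s) * x$b * (x v* Q)$a + (1 - exp (-s)) * Q$b$a * x$b"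
    by (simp add: vector_matrix_mult_nth sum_distrib_left)
  finally show ?thesis by (simp add: mult_ac)
qed

lemma moment2_correction_has_derivative:
  "((\<lambda>s. moment2_correction Q x a b s) has_real_derivative
     ((if a = b then s * (x v* Q)$a / 2 else 0)
      + (\<Sum>j\<in>UNIV. Q$j$a * neutral_moment2 x j b s + Q$j$b * neutral_moment2 x j a s) / 2
      - moment2_correction Q x a b s)) (at s within A)"
  unfolding sum.distrib sum_mult_neutral_moment2 moment2_correction_def
  by (cases "a = b") (auto intro!: derivative_eq_intros simp: algebra_simps add_divide_distrib diff_divide_distrib)

section \<open>Expansion of the moments in \<open>\<theta>\<close>\<close>

context wright_fisher
begin

lemma mean_0: "mean a 0 = x$a"
  using integral_unique[OF mean_has_integral[of 0 a]] by simp

lemma moment2_0: "moment2 a b 0 = x$a * x$b"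
  using integral_unique[OF moment2_has_integral[of 0 a b]] by simp

lemma continuous_on_mean: "0 \<le> t \<Longrightarrow> continuous_on {0..t} (mean a)"
  by (rule continuous_on_of_has_integral_indefinite[OF _ mean_has_integral])

lemma continuous_on_moment2: "0 \<le> t \<Longrightarrow> continuous_on {0..t} (moment2 a b)"
  by (rule continuous_on_of_has_integral_indefinite[OF _ moment2_has_integral])

lemma mean_has_derivative:
  assumes z: "z \<in> {0..t}"
  shows "(mean a has_real_derivative \<theta> / 2 * (\<Sum>j\<in>UNIV. Q$j$a * mean j z)) (at z within {0..t})"
proof -
  have "continuous_on {0..t} (\<lambda>r. \<theta> / 2 * (\<Sum>j\<in>UNIV. Q$j$a * mean j r))"
    using z by (auto intro!: continuous_intros continuous_on_mean)
  from has_real_derivative_of_has_integral_indefinite[OF mean_has_integral this z] show ?thesis .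
qed

lemma moment2_has_derivative:
  assumes z: "z \<in> {0..t}"
  shows "(moment2 a b has_real_derivative
           (if a = b then mean a z else 0) - moment2 a b z
             + \<theta> / 2 * (\<Sum>j\<in>UNIV. Q$j$a * moment2 j b z) + \<theta> / 2 * (\<Sum>j\<in>UNIV. Q$j$b * moment2 j a z))
         (at z within {0..t})"
proof -
  have "continuous_on {0..t} (\<lambda>r. (if a = b then mean a r else 0) - moment2 a b r
      + \<theta> / 2 * (\<Sum>j\<in>UNIV. Q$j$a * moment2 j b r) + \<theta> / 2 * (\<Sum>j\<in>UNIV. Q$j$b * moment2 j a r))"
    using z by (cases "a = b") (auto intro!: continuous_intros continuous_on_mean continuous_on_moment2)
  from has_real_derivative_of_has_integral_indefinite[OF moment2_has_integral this z] show ?thesis .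
qed

lemma abs_mutation_term_le:
  assumes "\<And>j. \<bar>f j\<bar> \<le> c"
  shows "\<bar>\<theta> / 2 * (\<Sum>j\<in>UNIV. Q$j$a * f j)\<bar> \<le> \<theta> / 2 * (real CARD('d) * c)"
proof -
  have "\<bar>\<Sum>j\<in>UNIV. Q$j$a * f j\<bar> \<le> real CARD('d) * c"
    using abs_mult_le[OF Q_bound assms] by (intro abs_sum_le_card_mult) simp
  then show ?thesis using nonneg by (simp add: abs_mult mult_left_mono)
qed

lemma mean_increment_bound:
  assumes z: "z \<in> {0..t}"
  shows "\<bar>mean a z - x$a\<bar> \<le> \<theta> / 2 * real CARD('d) * t"
proof -
  have bound: "\<bar>\<theta> / 2 * (\<Sum>j\<in>UNIV. Q$j$a * mean j y)\<bar> \<le> \<theta> / 2 * real CARD('d)"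
    if "y \<in> {0..t}" for y
    using abs_mutation_term_le[of "\<lambda>j. mean j y" 1] abs_mean_le_1 that by simp
  have "\<bar>mean a z - x$a\<bar> \<le> \<theta> / 2 * real CARD('d) * z"
    using increment_le_of_derivative_bound[OF mean_has_derivative bound z] by (simp add: mean_0)
  also have "\<dots> \<le> \<theta> / 2 * real CARD('d) * t"
    using z nonneg by (intro mult_left_mono) auto
  finally show ?thesis .
qed

lemma mean_first_order:
  assumes z: "z \<in> {0..t}"
  shows "\<bar>mean a z - x$a - \<theta> * z / 2 * (x v* Q)$a\<bar> \<le> (\<theta> / 2 * real CARD('d))^2 * t * z"
proof -
  have deriv: "((\<lambda>y. mean a y - \<theta> * y / 2 * (x v* Q)$a) has_real_derivative
      \<theta> / 2 * (\<Sum>j\<in>UNIV. Q$j$a * (mean j y - x$j))) (at y within {0..t})" if "y \<in> {0..t}" for y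
  proof (rule DERIV_cong)
    show "((\<lambda>y. mean a y - \<theta> * y / 2 * (x v* Q)$a) has_real_derivative
        \<theta> / 2 * (\<Sum>j\<in>UNIV. Q$j$a * mean j y) - \<theta> * 1 / 2 * (x v* Q)$a) (at y within {0..t})"
      by (intro DERIV_diff mean_has_derivative[OF that] DERIV_cmult_right DERIV_cdivide DERIV_cmult
          DERIV_ident)
    show "\<theta> / 2 * (\<Sum>j\<in>UNIV. Q$j$a * mean j y) - \<theta> * 1 / 2 * (x v* Q)$a
        = \<theta> / 2 * (\<Sum>j\<in>UNIV. Q$j$a * (mean j y - x$j))"
      by (simp add: vector_matrix_mult_nth right_diff_distrib sum_subtractf mult_ac)
  qed
  have bound: "\<bar>\<theta> / 2 * (\<Sum>j\<in>UNIV. Q$j$a * (mean j y - x$j))\<bar> \<le> (\<theta> / 2 * real CARD('d))^2 * t"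
    if y: "y \<in> {0..t}" for y
  proof -
    from abs_mutation_term_le[OF mean_increment_bound[OF y]] show ?thesis by (simp add: power2_eq_square mult_ac)
  qed
  show ?thesis
    using increment_le_of_derivative_bound[OF deriv bound z] by (simp add: mean_0)
qed

lemma moment2_zeroth_order:
  assumes z: "z \<in> {0..t}"
  shows "\<bar>moment2 a b z - neutral_moment2 x a b z\<bar> \<le> \<theta> * real CARD('d) * (t + 1) * t"
proof -
  define mutation where "mutation c e y = \<theta> / 2 * (\<Sum>j\<in>UNIV. Q$j$c * moment2 j e y)" for c e y
  define r where "r y = (if a = b then mean a y - x$a else 0) + mutation a b y + mutation b a y" for y
  have deriv: "((\<lambda>y. moment2 a b y - neutral_moment2 x a b y) has_real_derivative
      r y - (moment2 a b y - neutral_moment2 x a b y)) (at y within {0..t})" if "y \<in> {0..t}" for y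
    by (rule DERIV_cong[OF DERIV_diff[OF moment2_has_derivative[OF that] neutral_moment2_has_derivative]])
      (simp add: r_def mutation_def)
  have bound: "\<bar>r y\<bar> \<le> \<theta> * real CARD('d) * (t + 1)" if y: "y \<in> {0..t}" for y
  proof -
    have mutation_bound: "\<bar>mutation c e y\<bar> \<le> \<theta> / 2 * real CARD('d)" for c e
      using abs_mutation_term_le[of "\<lambda>j. moment2 j e y" 1] abs_moment2_le_1 y by (simp add: mutation_def)
    have "\<bar>if a = b then mean a y - x$a else 0\<bar> \<le> \<theta> / 2 * real CARD('d) * t"
      using mean_increment_bound[OF y, of a] nonneg y by auto
    then have "\<bar>r y\<bar> \<le> \<theta> / 2 * real CARD('d) * t + \<theta> / 2 * real CARD('d) + \<theta> / 2 * real CARD('d)"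
      unfolding r_def using mutation_bound[of a b] mutation_bound[of b a] by linarith
    also have "\<dots> \<le> \<theta> * real CARD('d) * (t + 1)"
      using nonneg y by (simp add: algebra_simps)
    finally show ?thesis .
  qed
  have "\<bar>moment2 a b z - neutral_moment2 x a b z\<bar> \<le> \<theta> * real CARD('d) * (t + 1) * z"
    using relaxation_bound[OF deriv bound _ z] by (simp add: moment2_0 neutral_moment2_0)
  also have "\<dots> \<le> \<theta> * real CARD('d) * (t + 1) * t"
    using z nonneg by (intro mult_left_mono) auto
  finally show ?thesis .
qed

lemma moment2_first_order:
  assumes t: "0 \<le> t"
  shows "\<bar>moment2 a b t - neutral_moment2 x a b t - \<theta> * moment2_correction Q x a b t\<bar>
           \<le> (\<theta> * real CARD('d) * t)^2 * (2 * t + 1)"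
proof -
  define mutation where
    "mutation c e y = \<theta> / 2 * (\<Sum>j\<in>UNIV. Q$j$c * (moment2 j e y - neutral_moment2 x j e y))" for c e y
  define r where
    "r y = (if a = b then mean a y - x$a - \<theta> * y / 2 * (x v* Q)$a else 0) + mutation a b y + mutation b a y"
    for y
  define e where "e y = moment2 a b y - neutral_moment2 x a b y - \<theta> * moment2_correction Q x a b y" for y
  have deriv: "(e has_real_derivative r y - e y) (at y within {0..t})" if "y \<in> {0..t}" for y
    unfolding e_def
    by (rule DERIV_cong[OF DERIV_diff[OF DERIV_diff[OF moment2_has_derivative[OF that]
          neutral_moment2_has_derivative] DERIV_cmult[OF moment2_correction_has_derivative]]])
      (cases "a = b";
       simp add: r_def mutation_def right_diff_distrib sum_subtractf sum.distrib algebra_simps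
         add_divide_distrib diff_divide_distrib sum_distrib_left[symmetric])
  have bound: "\<bar>r y\<bar> \<le> (\<theta> * real CARD('d))^2 * t * (2 * t + 1)" if y: "y \<in> {0..t}" for y
  proof -
    have mutation_bound:
      "\<bar>mutation c e y\<bar> \<le> \<theta> / 2 * (real CARD('d) * (\<theta> * real CARD('d) * (t + 1) * t))" for c e
      unfolding mutation_def by (rule abs_mutation_term_le[OF moment2_zeroth_order[OF y]])
    have "\<bar>if a = b then mean a y - x$a - \<theta> * y / 2 * (x v* Q)$a else 0\<bar>
        \<le> (\<theta> / 2 * real CARD('d))^2 * t * y"
      using mean_first_order[OF y, of a] y by auto
    also have "\<dots> \<le> (\<theta> / 2 * real CARD('d))^2 * t * t"
      using y t by (intro mult_left_mono) auto
    finally have "\<bar>r y\<bar> \<le> (\<theta> / 2 * real CARD('d))^2 * t * t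
        + 2 * (\<theta> / 2 * (real CARD('d) * (\<theta> * real CARD('d) * (t + 1) * t)))"
      unfolding r_def using mutation_bound[of a b] mutation_bound[of b a] by linarith
    also have "\<dots> = 5 / 4 * (\<theta> * real CARD('d) * t)^2 + (\<theta> * real CARD('d))^2 * t"
      by (simp add: power2_eq_square algebra_simps)
    also have "\<dots> \<le> (\<theta> * real CARD('d))^2 * t * (2 * t + 1)"
      using zero_le_power2[of "\<theta> * real CARD('d) * t"] by (simp add: power2_eq_square algebra_simps)
    finally show ?thesis .
  qed
  have "\<bar>e t\<bar> \<le> (\<theta> * real CARD('d))^2 * t * (2 * t + 1) * t"
    using relaxation_bound[OF deriv bound, of t] t
    by (simp add: e_def moment2_0 neutral_moment2_0 moment2_correction_0)
  then show ?thesis by (simp add: e_def power2_eq_square mult_ac)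
qed

end

lemma moment2_first_order_smallo:
  fixes P :: "real^'d::finite^'d" and M :: "real \<Rightarrow> 'w measure"
    and X :: "real \<Rightarrow> real \<Rightarrow> 'w \<Rightarrow> real^'d"
  assumes P: "stochastic P" and t: "0 \<le> t" and WF: "\<And>\<theta>. \<theta> > 0 \<Longrightarrow> WF_process \<theta> P x (M \<theta>) (X \<theta>)"
  shows "(\<lambda>\<theta>. (\<integral>\<omega>. X \<theta> t \<omega> $ a * X \<theta> t \<omega> $ b \<partial>M \<theta>) - neutral_moment2 x a b t
              - \<theta> * moment2_correction (P - mat 1) x a b t) \<in> o[at_right 0](\<lambda>\<theta>. \<theta>)"
proof (rule smallo_at_right_0_of_quadratic_bound[where C = "(real CARD('d) * t)^2 * (2 * t + 1)"])
  fix \<theta> :: real assume \<theta>: "0 < \<theta>" "\<theta> \<le> 1"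
  interpret wright_fisher \<theta> P x "M \<theta>" "X \<theta>"
    using WF[OF \<theta>(1)] P \<theta> by unfold_locales auto
  show "\<bar>(\<integral>\<omega>. X \<theta> t \<omega> $ a * X \<theta> t \<omega> $ b \<partial>M \<theta>) - neutral_moment2 x a b t
          - \<theta> * moment2_correction (P - mat 1) x a b t\<bar> \<le> (real CARD('d) * t)^2 * (2 * t + 1) * \<theta>^2"
    using moment2_first_order[OF t, of a b] by (simp add: moment2_def power_mult_distrib mult_ac)
qed

section \<open>The matrix exponential to first order\<close>

lemma mpow_0 [simp]: "mpow A 0 = mat 1"
  by (simp add: mpow_def)

lemma mpow_Suc: "mpow A (Suc k) = A ** mpow A k"
  by (simp add: mpow_def)

lemma abs_mpow_nth_le:
  fixes A :: "real^'d::finite^'d"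
  assumes A: "\<And>i j. \<bar>A$i$j\<bar> \<le> c"
  shows "\<bar>mpow A k $ i $ j\<bar> \<le> (real CARD('d) * c)^k"
proof (induction k arbitrary: i j)
  case 0
  then show ?case by (simp add: mat_def)
next
  case (Suc k)
  have "\<bar>\<Sum>l\<in>UNIV. A$i$l * mpow A k $ l $ j\<bar> \<le> real CARD('d) * (c * (real CARD('d) * c)^k)"
    by (intro abs_sum_le_card_mult abs_mult_le A Suc.IH)
  then show ?case by (simp add: mpow_Suc matrix_matrix_mult_def mult_ac)
qed

lemma mexp_nth_sums:
  fixes A :: "real^'d::finite^'d"
  assumes A: "\<And>i j. \<bar>A$i$j\<bar> \<le> c"
  shows "(\<lambda>k. mpow A k $ i $ j / fact k) sums (mexp A $ i $ j)"
proof -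
  define f where "f k = (1 / fact k) *\<^sub>R mpow A k" for k
  have "summable (\<lambda>k. f k $ i $ j)" for i j
  proof (rule summable_comparison_test'[of "\<lambda>k. inverse (fact k) * (real CARD('d) * c) ^ k" 0])
    show "summable (\<lambda>k. inverse (fact k) * (real CARD('d) * c) ^ k)" by (rule summable_exp)
    show "norm (f k $ i $ j) \<le> inverse (fact k) * (real CARD('d) * c) ^ k" for k
      using abs_mpow_nth_le[OF A, of k i j] by (simp add: f_def field_simps)
  qed
  then have entries: "(\<lambda>k. f k $ i $ j) sums (\<Sum>k. f k $ i $ j)" for i j
    by (simp add: summable_sums)
  have "f sums (\<chi> i j. \<Sum>k. f k $ i $ j)"
    unfolding sums_def
  proof (intro vec_tendstoI)
    show "((\<lambda>n. (\<Sum>k<n. f k) $ i $ j) \<longlongrightarrow> (\<chi> i j. \<Sum>k. f k $ i $ j) $ i $ j) sequentially" for i j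
      using entries[of i j] unfolding sums_def by (simp add: sum_component)
  qed
  then have "mexp A = (\<chi> i j. \<Sum>k. f k $ i $ j)"
    unfolding mexp_def f_def[symmetric] by (simp add: sums_iff)
  then show ?thesis using entries[of i j] by (simp add: f_def)
qed

lemma abs_mexp_nth_sub_linear_le:
  fixes A :: "real^'d::finite^'d"
  assumes A: "\<And>i j. \<bar>A$i$j\<bar> \<le> c"
  shows "\<bar>mexp A $ i $ j - mat 1 $ i $ j - A $ i $ j\<bar> \<le> (real CARD('d) * c)^2 * exp (real CARD('d) * c)"
proof -
  define C where "C = real CARD('d) * c"
  define g where "g k = mpow A k $ i $ j / fact k" for k
  have "(\<lambda>k. g (k + 2)) sums (mexp A $ i $ j - (g 0 + g 1))"
    using sums_split_initial_segment[OF mexp_nth_sums[OF A], of 2] by (simp add: g_def numeral_2_eq_2)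
  moreover have "g 0 + g 1 = mat 1 $ i $ j + A $ i $ j"
    by (simp add: g_def mpow_Suc)
  ultimately have "mexp A $ i $ j - mat 1 $ i $ j - A $ i $ j = (\<Sum>k. g (k + 2))"
    by (simp add: sums_iff)
  also have "\<bar>\<dots>\<bar> \<le> (\<Sum>k. C^2 * (inverse (fact k) * C ^ k))"
  proof -
    have "C \<ge> 0" using A[of i j] by (simp add: C_def)
    have "\<bar>g (k + 2)\<bar> \<le> C^2 * (inverse (fact k) * C ^ k)" for k
    proof -
      have "\<bar>g (k + 2)\<bar> \<le> C ^ (k + 2) / fact (k + 2)"
        using abs_mpow_nth_le[OF A, of "k + 2" i j] by (simp add: g_def C_def divide_right_mono)
      also have "\<dots> \<le> C ^ (k + 2) / fact k"
        using \<open>C \<ge> 0\<close> by (intro divide_left_mono fact_mono) auto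
      finally show ?thesis by (simp add: power_add power2_eq_square field_simps)
    qed
    moreover have "summable (\<lambda>k. C^2 * (inverse (fact k) * C ^ k))" by (intro summable_mult summable_exp)
    ultimately show ?thesis using norm_suminf_le[of "\<lambda>k. g (k + 2)"] by simp
  qed
  also have "(\<Sum>k. C^2 * (inverse (fact k) * C ^ k)) = C^2 * exp C"
    using sums_unique[OF sums_mult[OF exp_converges[of C], of "C^2"]] by (simp add: divide_inverse mult_ac)
  finally show ?thesis by (simp add: C_def)
qed

lemma abs_simplex_mult_mexp_sub_linear_le:
  fixes A :: "real^'d::finite^'d"
  assumes A: "\<And>i j. \<bar>A$i$j\<bar> \<le> c" and x: "x \<in> prob_simplex"
  shows "\<bar>(x v* mexp A)$a - x$a - (x v* A)$a\<bar> \<le> (real CARD('d) * c)^2 * exp (real CARD('d) * c)"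
proof -
  define B where "B = (real CARD('d) * c)^2 * exp (real CARD('d) * c)"
  have "(x v* mexp A)$a - x$a - (x v* A)$a = (\<Sum>i\<in>UNIV. x$i * (mexp A $ i $ a - mat 1 $ i $ a - A $ i $ a))"
    by (simp add: vector_matrix_mult_nth right_diff_distrib sum_subtractf mat_def sum_mult_delta
        if_distrib[of "(*) _"] cong: if_cong)
  also have "\<bar>\<dots>\<bar> \<le> (\<Sum>i\<in>UNIV. x$i * B)"
    using prob_simplex_nth_bounds[OF x] abs_mexp_nth_sub_linear_le[OF A]
    by (intro order_trans[OF sum_abs] sum_mono) (simp add: abs_mult B_def mult_left_mono)
  also have "\<dots> = B"
    using x by (simp add: prob_simplex_def sum_distrib_right[symmetric])
  finally show ?thesis by (simp add: B_def)
qed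

lemma mexp_mutation_first_order:
  fixes P :: "real^'d::finite^'d"
  assumes P: "stochastic P" and x: "x \<in> prob_simplex" and t: "0 \<le> t" and \<theta>: "0 \<le> \<theta>" "\<theta> \<le> 1"
  shows "\<bar>(x v* mexp (t *\<^sub>R gammaM \<theta> P))$a - x$a - \<theta> * t / 2 * (x v* (P - mat 1))$a\<bar>
           \<le> \<theta>^2 * ((real CARD('d) * t / 2)^2 * exp (real CARD('d) * t / 2))"
proof -
  define c where "c = \<theta> * t / 2"
  have A: "t *\<^sub>R gammaM \<theta> P = c *\<^sub>R (P - mat 1)"
    by (simp add: gammaM_def c_def)
  have "\<bar>(c *\<^sub>R (P - mat 1))$i$j\<bar> \<le> c" for i j
    using stochastic_minus_id_bound[OF P, of i j] \<theta> t
    by (simp add: c_def abs_mult mult_left_le)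
  from abs_simplex_mult_mexp_sub_linear_le[OF this x, of a]
  have "\<bar>(x v* mexp (t *\<^sub>R gammaM \<theta> P))$a - x$a - \<theta> * t / 2 * (x v* (P - mat 1))$a\<bar>
      \<le> (\<theta> * (real CARD('d) * t / 2))^2 * exp (\<theta> * (real CARD('d) * t / 2))"
    by (simp add: A c_def vector_matrix_mult_nth sum_distrib_left mult_ac)
  also have "\<dots> = \<theta>^2 * ((real CARD('d) * t / 2)^2 * exp (\<theta> * (real CARD('d) * t / 2)))"
    by (simp add: power2_eq_square)
  also have "\<dots> \<le> \<theta>^2 * ((real CARD('d) * t / 2)^2 * exp (real CARD('d) * t / 2))"
    using \<theta> t by (intro mult_left_mono) (auto intro: mult_left_le_one_le)
  finally show ?thesis .
qed

lemma abs_mexp_mutation_sub_le: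
  fixes P :: "real^'d::finite^'d"
  assumes P: "stochastic P" and x: "x \<in> prob_simplex" and t: "0 \<le> t" and \<theta>: "0 \<le> \<theta>" "\<theta> \<le> 1"
  shows "\<bar>(x v* mexp (t *\<^sub>R gammaM \<theta> P))$i - x$i\<bar>
           \<le> \<theta> * (real CARD('d) * t / 2 + (real CARD('d) * t / 2)^2 * exp (real CARD('d) * t / 2))"
proof -
  define K where "K = (real CARD('d) * t / 2)^2 * exp (real CARD('d) * t / 2)"
  have "\<bar>\<theta> * t / 2 * (x v* (P - mat 1))$i\<bar> \<le> \<theta> * t / 2 * real CARD('d)"
    using abs_vector_matrix_mult_nth_le[OF x stochastic_minus_id_bound[OF P], of i] \<theta> t
    by (simp add: abs_mult mult_left_mono)
  moreover have "\<theta>^2 * K \<le> \<theta> * K"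
    using \<theta> by (intro mult_right_mono) (auto simp: K_def power2_eq_square mult_left_le_one_le)
  moreover have "\<bar>(x v* mexp (t *\<^sub>R gammaM \<theta> P))$i - x$i - \<theta> * t / 2 * (x v* (P - mat 1))$i\<bar> \<le> \<theta>^2 * K"
    using mexp_mutation_first_order[OF P x t \<theta>, of i] by (simp add: K_def)
  ultimately have "\<bar>(x v* mexp (t *\<^sub>R gammaM \<theta> P))$i - x$i\<bar> \<le> \<theta> * t / 2 * real CARD('d) + \<theta> * K"
    by linarith
  then show ?thesis by (simp add: K_def algebra_simps)
qed

section \<open>Samples of size two\<close>

lemma homozygous_formula_eq:
  fixes P :: "real^'d::finite^'d" and m x :: "real^'d"
  shows "(x$a)^2 * (1 - \<theta> * t) * exp (-t) + \<theta> * t * exp (-t) * x$a * (\<Sum>j\<in>UNIV. x$j * P$j$a)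
          + m$a * (1 - exp (-t))
          + \<theta> * (m$a * (P$a$a - 1) - (1/2) * (m v* (P - mat 1))$a) * (1 - (1 + t) * exp (-t))
         - (neutral_moment2 x a a t + \<theta> * moment2_correction (P - mat 1) x a a t)
       = (m$a - x$a - \<theta> * t / 2 * (x v* (P - mat 1))$a) * (1 - exp (-t))
         + \<theta> * (1 - (1 + t) * exp (-t))
             * ((m$a - x$a) * (P - mat 1)$a$a - (1/2) * ((m - x) v* (P - mat 1))$a)"
  unfolding vector_matrix_mult_nth[symmetric] neutral_moment2_def moment2_correction_def
  by (simp add: mat_1_nth power2_eq_square algebra_simps add_divide_distrib diff_divide_distrib)

lemma heterozygous_formula_eq:
  fixes P :: "real^'d::finite^'d" and m x :: "real^'d"
  assumes "a \<noteq> b"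
  shows "2 * x$a * x$b * (1 - \<theta> * t) * exp (-t)
          + \<theta> * t * exp (-t) * (\<Sum>j\<in>UNIV. x$a * x$j * P$j$b + x$b * x$j * P$j$a)
          + \<theta> * (m$a * P$a$b + m$b * P$b$a) * (1 - (1 + t) * exp (-t))
         - 2 * (neutral_moment2 x a b t + \<theta> * moment2_correction (P - mat 1) x a b t)
       = \<theta> * (1 - (1 + t) * exp (-t)) * ((m$a - x$a) * P$a$b + (m$b - x$b) * P$b$a)"
proof -
  have "(\<Sum>j\<in>UNIV. x$a * x$j * P$j$b + x$b * x$j * P$j$a)
      = x$a * (\<Sum>j\<in>UNIV. x$j * P$j$b) + x$b * (\<Sum>j\<in>UNIV. x$j * P$j$a)"
    by (simp add: sum.distrib sum_distrib_left mult_ac)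
  then show ?thesis
    unfolding vector_matrix_mult_nth[symmetric] neutral_moment2_def moment2_correction_def
    using assms by (simp add: mat_1_nth algebra_simps add_divide_distrib diff_divide_distrib)
qed

lemma mult_two_unitv: "mult (\<lambda>j. 2 * unitv a j) (y::real^'d::finite) = y$a * y$a"
proof -
  have "(\<Sum>j\<in>UNIV. 2 * unitv a j) = 2"
    by (simp add: unitv_def sum_distrib_left[symmetric])
  moreover have "(\<Prod>j\<in>UNIV. fact (2 * unitv a j)) = (\<Prod>j\<in>UNIV. if j = a then 2 else (1::real))"
    by (rule prod.cong) (auto simp: unitv_def)
  moreover have "(\<Prod>j\<in>UNIV. y$j ^ (2 * unitv a j)) = (\<Prod>j\<in>UNIV. if j = a then (y$a)^2 else 1)"
    by (rule prod.cong) (auto simp: unitv_def)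
  ultimately show ?thesis by (simp add: mult_def power2_eq_square)
qed

lemma mult_unitv_add_unitv:
  assumes "a \<noteq> b"
  shows "mult (\<lambda>j. unitv a j + unitv b j) (y::real^'d::finite) = 2 * (y$a * y$b)"
proof -
  have "(\<Sum>j\<in>UNIV. unitv a j + unitv b j) = 2"
    using assms by (simp add: unitv_def sum.distrib)
  moreover have "(\<Prod>j\<in>UNIV. fact (unitv a j + unitv b j)) = (1::real)"
    by (rule prod.neutral) (use assms in \<open>auto simp: unitv_def\<close>)
  moreover have "(\<Prod>j\<in>UNIV. y$j ^ (unitv a j + unitv b j)) = y$a * y$b"
    by (simp add: power_add prod.distrib unitv_def prod_power_delta)
  ultimately show ?thesis by (simp add: mult_def)
qed

lemma homozygous_formula_smallo:
  fixes P :: "real^'d::finite^'d"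
  assumes P: "stochastic P" and x: "x \<in> prob_simplex" and t: "0 \<le> t"
  shows "(\<lambda>\<theta>. (x$a)^2 * (1 - \<theta> * t) * exp (-t)
          + \<theta> * t * exp (-t) * x$a * (\<Sum>j\<in>UNIV. x$j * P$j$a)
          + (x v* mexp (t *\<^sub>R gammaM \<theta> P))$a * (1 - exp (-t))
          + \<theta> * ( (x v* mexp (t *\<^sub>R gammaM \<theta> P))$a * (P$a$a - 1)
                  - (1/2) * ((x v* mexp (t *\<^sub>R gammaM \<theta> P)) v* (P - mat 1))$a )
              * (1 - (1 + t) * exp (-t))
          - (neutral_moment2 x a a t + \<theta> * moment2_correction (P - mat 1) x a a t))
      \<in> o[at_right 0](\<lambda>\<theta>. \<theta>)"
proof -
  define D where "D = real CARD('d)"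
  define K where "K = (D * t / 2)^2 * exp (D * t / 2)"
  define L where "L = D * t / 2 + K"
  show ?thesis
  proof (rule smallo_at_right_0_of_quadratic_bound[where C = "K + L + D * L / 2"])
    fix \<theta> :: real assume \<theta>: "0 < \<theta>" "\<theta> \<le> 1"
    define m where "m = x v* mexp (t *\<^sub>R gammaM \<theta> P)"
    have remainder: "\<bar>m$a - x$a - \<theta> * t / 2 * (x v* (P - mat 1))$a\<bar> \<le> \<theta>^2 * K"
      using mexp_mutation_first_order[OF P x t, of \<theta> a] \<theta> by (simp add: m_def K_def D_def)
    have increment: "\<bar>m$i - x$i\<bar> \<le> \<theta> * L" for i
      using abs_mexp_mutation_sub_le[OF P x t, of \<theta> i] \<theta> by (simp add: m_def K_def L_def D_def)
    have "\<bar>((m - x) v* (P - mat 1))$a\<bar> \<le> D * (\<theta> * L)"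
      unfolding vector_matrix_mult_nth D_def
      by (intro abs_sum_le_card_mult order_trans[OF abs_mult_le[OF _ stochastic_minus_id_bound[OF P]]])
        (use increment in auto)
    then have "\<bar>(m$a - x$a) * (P - mat 1)$a$a - (1/2) * ((m - x) v* (P - mat 1))$a\<bar> \<le> \<theta> * L + D * (\<theta> * L) / 2"
      using abs_mult_le[OF increment stochastic_minus_id_bound[OF P], of a a a] by linarith
    then have "\<bar>\<theta> * (1 - (1 + t) * exp (-t))
             * ((m$a - x$a) * (P - mat 1)$a$a - (1/2) * ((m - x) v* (P - mat 1))$a)\<bar>
        \<le> \<theta> * 1 * (\<theta> * L + D * (\<theta> * L) / 2)"
      using \<theta> abs_one_minus_one_plus_exp_le[OF t] by (intro abs_mult_le) (auto simp: abs_mult)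
    moreover have "\<bar>(m$a - x$a - \<theta> * t / 2 * (x v* (P - mat 1))$a) * (1 - exp (-t))\<bar> \<le> \<theta>^2 * K * 1"
      using remainder t by (intro abs_mult_le) auto
    ultimately show "\<bar>(x$a)^2 * (1 - \<theta> * t) * exp (-t)
          + \<theta> * t * exp (-t) * x$a * (\<Sum>j\<in>UNIV. x$j * P$j$a)
          + (x v* mexp (t *\<^sub>R gammaM \<theta> P))$a * (1 - exp (-t))
          + \<theta> * ( (x v* mexp (t *\<^sub>R gammaM \<theta> P))$a * (P$a$a - 1)
                  - (1/2) * ((x v* mexp (t *\<^sub>R gammaM \<theta> P)) v* (P - mat 1))$a )
              * (1 - (1 + t) * exp (-t))
          - (neutral_moment2 x a a t + \<theta> * moment2_correction (P - mat 1) x a a t)\<bar>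
        \<le> (K + L + D * L / 2) * \<theta>^2"
      unfolding m_def[symmetric] homozygous_formula_eq by (simp add: power2_eq_square algebra_simps)
  qed
qed

lemma heterozygous_formula_smallo:
  fixes P :: "real^'d::finite^'d"
  assumes P: "stochastic P" and x: "x \<in> prob_simplex" and t: "0 \<le> t" and ab: "a \<noteq> b"
  shows "(\<lambda>\<theta>. 2 * x$a * x$b * (1 - \<theta> * t) * exp (-t)
          + \<theta> * t * exp (-t) * (\<Sum>j\<in>UNIV. x$a * x$j * P$j$b + x$b * x$j * P$j$a)
          + \<theta> * ( (x v* mexp (t *\<^sub>R gammaM \<theta> P))$a * P$a$b
                  + (x v* mexp (t *\<^sub>R gammaM \<theta> P))$b * P$b$a )
              * (1 - (1 + t) * exp (-t))
          - 2 * (neutral_moment2 x a b t + \<theta> * moment2_correction (P - mat 1) x a b t))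
      \<in> o[at_right 0](\<lambda>\<theta>. \<theta>)"
proof -
  define D where "D = real CARD('d)"
  define L where "L = D * t / 2 + (D * t / 2)^2 * exp (D * t / 2)"
  show ?thesis
  proof (rule smallo_at_right_0_of_quadratic_bound[where C = "2 * L"])
    fix \<theta> :: real assume \<theta>: "0 < \<theta>" "\<theta> \<le> 1"
    define m where "m = x v* mexp (t *\<^sub>R gammaM \<theta> P)"
    have increment: "\<bar>m$i - x$i\<bar> \<le> \<theta> * L" for i
      using abs_mexp_mutation_sub_le[OF P x t, of \<theta> i] \<theta> by (simp add: m_def L_def D_def)
    have off_diagonal: "\<bar>P$i$j\<bar> \<le> 1" if "i \<noteq> j" for i j
      using stochastic_minus_id_bound[OF P, of i j] that by (simp add: mat_1_nth)
    have "\<bar>(m$a - x$a) * P$a$b + (m$b - x$b) * P$b$a\<bar> \<le> \<theta> * L * 1 + \<theta> * L * 1"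
      using abs_mult_le[OF increment[of a] off_diagonal[OF ab]]
        abs_mult_le[OF increment[of b] off_diagonal[OF ab[symmetric]]] by linarith
    then have "\<bar>\<theta> * (1 - (1 + t) * exp (-t)) * ((m$a - x$a) * P$a$b + (m$b - x$b) * P$b$a)\<bar>
        \<le> \<theta> * 1 * (\<theta> * L * 1 + \<theta> * L * 1)"
      using \<theta> abs_one_minus_one_plus_exp_le[OF t] by (intro abs_mult_le) (auto simp: abs_mult)
    then show "\<bar>2 * x$a * x$b * (1 - \<theta> * t) * exp (-t)
          + \<theta> * t * exp (-t) * (\<Sum>j\<in>UNIV. x$a * x$j * P$j$b + x$b * x$j * P$j$a)
          + \<theta> * ( (x v* mexp (t *\<^sub>R gammaM \<theta> P))$a * P$a$b
                  + (x v* mexp (t *\<^sub>R gammaM \<theta> P))$b * P$b$a )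
              * (1 - (1 + t) * exp (-t))
          - 2 * (neutral_moment2 x a b t + \<theta> * moment2_correction (P - mat 1) x a b t)\<bar>
        \<le> 2 * L * \<theta>^2"
      unfolding m_def[symmetric] heterozygous_formula_eq[OF ab] by (simp add: power2_eq_square algebra_simps)
  qed
qed

theorem mainTheorem8:
  fixes P :: "real^'d^'d" and x :: "real^'d" and t :: real
    and M :: "real \<Rightarrow> 'w measure" and X :: "real \<Rightarrow> real \<Rightarrow> 'w \<Rightarrow> real^'d"
  assumes d2: "CARD('d) \<ge> 2"
    and P: "stochastic P"
    and x: "x \<in> prob_simplex"
    and t: "t \<ge> 0"
    and WF: "\<And>\<theta>. \<theta> > 0 \<Longrightarrow> WF_process \<theta> P x (M \<theta>) (X \<theta>)"
  shows
   "(\<forall>a. (\<lambda>\<theta>. (\<integral>\<omega>. mult (\<lambda>j. 2 * unitv a j) (X \<theta> t \<omega>) \<partial>M \<theta>)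
        - ( (x$a)^2 * (1 - \<theta> * t) * exp (-t)
          + \<theta> * t * exp (-t) * x$a * (\<Sum>j\<in>UNIV. x$j * P$j$a)
          + (x v* mexp (t *\<^sub>R gammaM \<theta> P))$a * (1 - exp (-t))
          + \<theta> * ( (x v* mexp (t *\<^sub>R gammaM \<theta> P))$a * (P$a$a - 1)
                  - (1/2) * ((x v* mexp (t *\<^sub>R gammaM \<theta> P)) v* (P - mat 1))$a )
              * (1 - (1 + t) * exp (-t))))
      \<in> o[at_right 0](\<lambda>\<theta>. \<theta>))
   \<and>
   (\<forall>a b. a \<noteq> b \<longrightarrow> (\<lambda>\<theta>. (\<integral>\<omega>. mult (\<lambda>j. unitv a j + unitv b j) (X \<theta> t \<omega>) \<partial>M \<theta>)
        - ( 2 * x$a * x$b * (1 - \<theta> * t) * exp (-t)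
          + \<theta> * t * exp (-t) * (\<Sum>j\<in>UNIV. x$a * x$j * P$j$b + x$b * x$j * P$j$a)
          + \<theta> * ( (x v* mexp (t *\<^sub>R gammaM \<theta> P))$a * P$a$b
                  + (x v* mexp (t *\<^sub>R gammaM \<theta> P))$b * P$b$a )
              * (1 - (1 + t) * exp (-t))))
      \<in> o[at_right 0](\<lambda>\<theta>. \<theta>))"
proof -
  note moment2 = moment2_first_order_smallo[OF P t WF]
  have twice_moment2: "(\<lambda>\<theta>. 2 * ((\<integral>\<omega>. X \<theta> t \<omega> $ a * X \<theta> t \<omega> $ b \<partial>M \<theta>) - neutral_moment2 x a b t
      - \<theta> * moment2_correction (P - mat 1) x a b t)) \<in> o[at_right 0](\<lambda>\<theta>. \<theta>)" for a b
    by (rule landau_o.small.cmult_in_iff[THEN iffD2, OF _ moment2]) simp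
  show ?thesis
    apply (intro conjI allI impI)
    subgoal for a
      using sum_in_smallo(2)[OF moment2[of a a] homozygous_formula_smallo[OF P x t, of a]]
      unfolding mult_two_unitv by (simp add: algebra_simps)
    subgoal premises ab for a b
      using sum_in_smallo(2)[OF twice_moment2[of a b] heterozygous_formula_smallo[OF P x t ab]]
      unfolding mult_unitv_add_unitv[OF ab] by (simp add: algebra_simps)
    done
qed

end
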